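(* Let $\mathcal{K}$ be a finite simplicial complex on which all simplex weights equal the same positive constant. Then for every $1$-simplex $e\in\mathcal{K}^{(1)}$, the original and augmented Forman--Ricci curvatures agree: $\mathbf{F}(e)=\mathbf{F}^{\mathrm{aug}}(e)$.
   Context: A finite abstract simplicial complex $\mathcal{K}$ is a finite collection of nonempty finite sets (simplices) closed under taking nonempty subsets; $\mathcal{K}^{(k)}$ is the set of its $k$-simplices (those with $k+1$ vertices). A weighted simplicial complex assigns a weight $w(\sigma)>0$ to each $\sigma\in\mathcal{K}$ (for a vertex $v$, $w(v)$ denotes $w(\{v\})$). Parallelism: two $1$-simplices $e,\hat e$ are parallel, written $\hat e\Vert e$, if $\hat e\ne e$ and exactly one of the following holds: (A) there is a $2$-simplex of $\mathcal{K}$ containing both $e$ and $\hat e$; (B) there is a vertex belonging to both $e$ and $\hat e$. Original Forman--Ricci curvature of a $1$-simplex $e$: $$\mathbf{F}(e)=w(e)\Biggl[\sum_{T\in\mathcal{K}^{(2)},\,T\supset e}\frac{w(e)}{w(T)}+\sum_{v\in e}\frac{w(v)}{w(e)}-\sum_{\hat e\Vert e}\Biggl|\sum_{T\in\mathcal{K}^{(2)},\,T\supset e,\hat e}\frac{\sqrt{w(e)w(\hat e)}}{w(T)}-\sum_{v\in e\cap\hat e}\frac{w(v)}{\sqrt{w(e)w(\hat e)}}\Biggr|\Biggr].$$ Augmented Forman--Ricci curvature of a $1$-simplex $e=\{v_1,v_2\}$: $$\mathbf{F}^{\mathrm{aug}}(e)=w(e)\Biggl[\frac{w(v_1)}{w(e)}+\frac{w(v_2)}{w(e)}+\sum_{T\in\mathcal{K}^{(2)},\,T\supset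 e}\frac{w(e)}{w(T)}-\sum_{\hat e\Vert e}\sqrt{\frac{w(e)}{w(\hat e)}}\Biggr].$$ *)

theory Defs
  imports Complex_Main
begin

definition finite_abstract_simplicial_complex :: "'a set set \<Rightarrow> bool" where
  "finite_abstract_simplicial_complex K \<longleftrightarrow>
     finite K \<and>
     (\<forall>\<sigma>\<in>K. finite \<sigma> \<and> \<sigma> \<noteq> {}) \<and>
     (\<forall>\<sigma>\<in>K. \<forall>\<tau>. \<tau> \<noteq> {} \<and> \<tau> \<subseteq> \<sigma> \<longrightarrow> \<tau> \<in> K)"

(* Only the values of w on K are meaningful. *)
definition weighted_simplicial_complex :: "'a set set \<Rightarrow> ('a set \<Rightarrow> real) \<Rightarrow> bool" where
  "weighted_simplicial_complex K w \<longleftrightarrow>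
     finite_abstract_simplicial_complex K \<and> (\<forall>\<sigma>\<in>K. w \<sigma> > 0)"

definition simplices :: "'a set set \<Rightarrow> nat \<Rightarrow> 'a set set" where
  "simplices K k = {\<sigma> \<in> K. card \<sigma> = k + 1}"

(* The inequality of truth values is the exclusive "exactly one of". *)
definition parallel_edges :: "'a set set \<Rightarrow> 'a set \<Rightarrow> 'a set \<Rightarrow> bool" where
  "parallel_edges K e' e \<longleftrightarrow>
     e \<in> simplices K 1 \<and> e' \<in> simplices K 1 \<and> e' \<noteq> e \<and>
     (\<exists>T \<in> simplices K 2. e \<subseteq> T \<and> e' \<subseteq> T) \<noteq> (\<exists>v. v \<in> e \<and> v \<in> e')"

definition forman_curvature :: "'a set set \<Rightarrow> ('a set \<Rightarrow> real) \<Rightarrow> 'a set \<Rightarrow> real" where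
  "forman_curvature K w e =
     w e * ((\<Sum>T | T \<in> simplices K 2 \<and> e \<subseteq> T. w e / w T)
            + (\<Sum>v\<in>e. w {v} / w e)
            - (\<Sum>e' | parallel_edges K e' e.
                 \<bar>(\<Sum>T | T \<in> simplices K 2 \<and> e \<subseteq> T \<and> e' \<subseteq> T. sqrt (w e * w e') / w T)
                  - (\<Sum>v \<in> e \<inter> e'. w {v} / sqrt (w e * w e'))\<bar>))"

definition augmented_forman_curvature ::
    "'a set set \<Rightarrow> ('a set \<Rightarrow> real) \<Rightarrow> 'a set \<Rightarrow> real" where
  "augmented_forman_curvature K w e =
     w e * ((\<Sum>v\<in>e. w {v} / w e)
            + (\<Sum>T | T \<in> simplices K 2 \<and> e \<subseteq> T. w e / w T)
            - (\<Sum>e' | parallel_edges K e' e. sqrt (w e / w e')))"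

lemma augmented_forman_curvature_edge:
  assumes "v1 \<noteq> v2"
  shows "augmented_forman_curvature K w {v1, v2} =
     w {v1, v2} * (w {v1} / w {v1, v2} + w {v2} / w {v1, v2}
            + (\<Sum>T | T \<in> simplices K 2 \<and> {v1, v2} \<subseteq> T. w {v1, v2} / w T)
            - (\<Sum>e' | parallel_edges K e' {v1, v2}. sqrt (w {v1, v2} / w e')))"
  using assms unfolding augmented_forman_curvature_def by simp

end

theory Submission
  imports Defs
begin

text \<open>
  The two curvatures differ only in their sums over parallel edges, so it suffices to compare the
  summands for a single parallel edge \<open>e'\<close>. Two edges of a common triangle are two 2-element subsets of a 3-element set, so they
  intersect. The triangle alternative in the definition of parallelism therefore never occurs
  alone, and parallel edges share a vertex but no triangle
  (\<open>parallel_edges_iff_vertex_no_triangle\<close>). Being distinct, they share exactly one vertex. Hence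
  the triangle sum inside the absolute value is empty, the vertex sum has a single term
  (\<open>parallel_edge_term\<close>), equal to \<open>c / sqrt (c * c) = 1\<close> when all weights are \<open>c\<close>, and the summand
  is \<open>\<bar>0 - 1\<bar> = 1\<close>, which is also the augmented summand \<open>sqrt (c / c)\<close>.
\<close>

lemma edges_of_triangle_meet:
  assumes "e \<in> simplices K 1" and "e' \<in> simplices K 1" and "T \<in> simplices K 2"
    and "e \<subseteq> T" and "e' \<subseteq> T"
  shows "e \<inter> e' \<noteq> {}"
proof
  assume disjoint: "e \<inter> e' = {}"
  have card: "card e = 2" "card e' = 2" "card T = 3"
    using assms(1-3) by (auto simp: simplices_def)
  then have finite: "finite e" "finite e'" "finite T"
    by (auto intro: card_ge_0_finite)
  have "card (e \<union> e') \<le> card T"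
    using assms(4,5) finite by (intro card_mono) auto
  then show False
    using disjoint finite card by (simp add: card_Un_disjoint)
qed

text \<open>
  Sharing a triangle forces sharing a vertex, so the exclusive disjunction collapses to its
  vertex alternative.
\<close>

lemma parallel_edges_iff_vertex_no_triangle:
  "parallel_edges K e' e \<longleftrightarrow>
     e \<in> simplices K 1 \<and> e' \<in> simplices K 1 \<and> e' \<noteq> e \<and> e \<inter> e' \<noteq> {} \<and>
     (\<forall>T \<in> simplices K 2. \<not> (e \<subseteq> T \<and> e' \<subseteq> T))"
  using edges_of_triangle_meet[of e K e'] unfolding parallel_edges_def by blast

lemma distinct_edges_meet_in_vertex:
  assumes "e \<in> simplices K 1" and "e' \<in> simplices K 1" and "e' \<noteq> e" and "e \<inter> e' \<noteq> {}"
  obtains v where "e \<inter> e' = {v}"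
proof -
  have "card e = 2" "card e' = 2"
    using assms(1,2) by (auto simp: simplices_def)
  then obtain a b a' b' where "e = {a, b}" "e' = {a', b'}"
    unfolding card_2_iff by blast
  then have "\<exists>v. e \<inter> e' = {v}"
    using assms(3,4) by auto
  then show thesis
    using that by blast
qed

text \<open>
  The contribution of a parallel edge to the original curvature for arbitrary positive
  weights: only the term of the common vertex survives.
\<close>

lemma parallel_edge_term:
  assumes "weighted_simplicial_complex K w" and "parallel_edges K e' e"
  obtains v where "e \<inter> e' = {v}" and "{v} \<in> K"
    and "\<bar>(\<Sum>T | T \<in> simplices K 2 \<and> e \<subseteq> T \<and> e' \<subseteq> T. sqrt (w e * w e') / w T)
          - (\<Sum>v \<in> e \<inter> e'. w {v} / sqrt (w e * w e'))\<bar>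
         = w {v} / sqrt (w e * w e')"
proof -
  have par: "e \<in> simplices K 1" "e' \<in> simplices K 1" "e' \<noteq> e" "e \<inter> e' \<noteq> {}"
    and "\<forall>T \<in> simplices K 2. \<not> (e \<subseteq> T \<and> e' \<subseteq> T)"
    using assms(2) unfolding parallel_edges_iff_vertex_no_triangle by blast+
  then have no_triangle: "{T. T \<in> simplices K 2 \<and> e \<subseteq> T \<and> e' \<subseteq> T} = {}"
    by blast
  obtain v where v: "e \<inter> e' = {v}"
    using distinct_edges_meet_in_vertex par by metis
  have in_K: "e \<in> K" "e' \<in> K"
    using par(1,2) by (auto simp: simplices_def)
  moreover have "{v} \<subseteq> e"
    using v by blast
  ultimately have v_in_K: "{v} \<in> K"
    using assms(1) unfolding weighted_simplicial_complex_def
      finite_abstract_simplicial_complex_def by blast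
  have "w {v} > 0" "w e > 0" "w e' > 0"
    using assms(1) v_in_K in_K unfolding weighted_simplicial_complex_def by blast+
  then have "\<bar>(\<Sum>T | T \<in> simplices K 2 \<and> e \<subseteq> T \<and> e' \<subseteq> T. sqrt (w e * w e') / w T)
          - (\<Sum>v \<in> e \<inter> e'. w {v} / sqrt (w e * w e'))\<bar>
         = w {v} / sqrt (w e * w e')"
    unfolding no_triangle v by simp
  then show thesis
    using that v v_in_K by blast
qed

theorem lemma2:
  fixes K :: "'a set set" and w :: "'a set \<Rightarrow> real" and c :: real
  assumes "weighted_simplicial_complex K w"
    and "c > 0"
    and "\<forall>\<sigma>\<in>K. w \<sigma> = c"
  shows "\<forall>e \<in> simplices K 1. forman_curvature K w e = augmented_forman_curvature K w e"
proof
  fix e assume "e \<in> simplices K 1"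
  have "(\<Sum>e' | parallel_edges K e' e.
           \<bar>(\<Sum>T | T \<in> simplices K 2 \<and> e \<subseteq> T \<and> e' \<subseteq> T. sqrt (w e * w e') / w T)
            - (\<Sum>v \<in> e \<inter> e'. w {v} / sqrt (w e * w e'))\<bar>)
        = (\<Sum>e' | parallel_edges K e' e. sqrt (w e / w e'))"
  proof (rule sum.cong[OF refl])
    fix e' assume "e' \<in> {e'. parallel_edges K e' e}"
    then have par: "parallel_edges K e' e"
      by simp
    then have "e \<in> K" "e' \<in> K"
      unfolding parallel_edges_def simplices_def by blast+
    then have w: "w e = c" "w e' = c"
      using assms(3) by blast+
    obtain v where "{v} \<in> K" and "e \<inter> e' = {v}"
      and summand: "\<bar>(\<Sum>T | T \<in> simplices K 2 \<and> e \<subseteq> T \<and> e' \<subseteq> T. sqrt (w e * w e') / w T)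
            - (\<Sum>v \<in> e \<inter> e'. w {v} / sqrt (w e * w e'))\<bar>
           = w {v} / sqrt (w e * w e')"
      by (rule parallel_edge_term[OF assms(1) par])
    have "w {v} = c"
      using assms(3) \<open>{v} \<in> K\<close> by blast
    then have "w {v} / sqrt (w e * w e') = sqrt (w e / w e')"
      using assms(2) w by simp
    with summand show "\<bar>(\<Sum>T | T \<in> simplices K 2 \<and> e \<subseteq> T \<and> e' \<subseteq> T. sqrt (w e * w e') / w T)
            - (\<Sum>v \<in> e \<inter> e'. w {v} / sqrt (w e * w e'))\<bar> = sqrt (w e / w e')"
      by (rule trans)
  qed
  then show "forman_curvature K w e = augmented_forman_curvature K w e"
    unfolding forman_curvature_def augmented_forman_curvature_def by simp
qed

end
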